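(* Let $s,v,m$ be positive integers and $\epsilon\in\{1,-1\}$, excluding the case $\epsilon=-1$, $vm^2\le4$. Put $d=svm/2$, $k=s^2v(vm^2+4\epsilon)/4$, $\xi=d+\sqrt{k}$, and $f_\xi(x)=svm-\epsilon s^2v/x$. Suppose $\xi$ is not of either of the following forms: (1) $\xi=s\cdot\frac{3+\sqrt5}{2}$ or $\xi=s\cdot\frac{5+\sqrt5}{2}$, where $s$ divides some Fibonacci number $F_{2n+1}$ of odd index ($F_0=0$, $F_1=1$, $F_{n+1}=F_n+F_{n-1}$); (2) $\xi=s(2+\sqrt2)$, where $s$ divides some Pell number $G_{2n+1}$ of odd index ($G_0=0$, $G_1=1$, $G_{n+1}=2G_n+G_{n-1}$). Then the orbit $\{f_\xi^n(\infty):n\ge1\}$ contains every Pellian fraction for $\xi$.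
   Context: $\xi$ is a real quadratic algebraic integer, a root of $x^2-tx-u=0$ with $t=svm$, $u=\epsilon s^2v$, and $\xi>|\bar\xi|$ where $\bar\xi=d-\sqrt k$. A fraction $p/q$ with $p,q\in\mathbb{Z}$ is called Pellian for $\xi$ if $q>0$, $p/q>t/2$, and $p^2-tpq-uq^2=\pm1$. (These are exactly the convergents of the continued fraction of $\xi$ formed from a number of terms divisible by the period length.)
   Formalization: The map is taken as f_ξ(x) = svm + εs²v/x, which fixes ξ; with the printed minus sign the claim is false (s=v=m=ε=1: the orbit of ∞ is 1, 0, ∞, … but 2/1 is Pellian). *)

theory Defs
  imports Complex_Main "HOL-Number_Theory.Fib"
begin

definition trc :: "int \<Rightarrow> int \<Rightarrow> int \<Rightarrow> int" where
  "trc s v m = s * v * m"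

text \<open>The negative of the norm of \<open>\<xi>\<close>, so that \<open>\<xi>\<^sup>2 - t * \<xi> - u = 0\<close>
  with \<open>t = trc s v m\<close> and \<open>u = ncf s v \<epsilon>\<close>.\<close>

definition ncf :: "int \<Rightarrow> int \<Rightarrow> int \<Rightarrow> int" where
  "ncf s v \<epsilon> = \<epsilon> * s\<^sup>2 * v"

definition dd :: "int \<Rightarrow> int \<Rightarrow> int \<Rightarrow> real" where
  "dd s v m = of_int (s * v * m) / 2"

definition kk :: "int \<Rightarrow> int \<Rightarrow> int \<Rightarrow> int \<Rightarrow> real" where
  "kk s v m \<epsilon> = of_int (s\<^sup>2 * v * (v * m\<^sup>2 + 4 * \<epsilon>)) / 4"

definition xi :: "int \<Rightarrow> int \<Rightarrow> int \<Rightarrow> int \<Rightarrow> real" where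
  "xi s v m \<epsilon> = dd s v m + sqrt (kk s v m \<epsilon>)"

text \<open>The map \<open>f\<^sub>\<xi>\<close> acts on the real projective line, modelled as \<open>real option\<close> with
  \<open>None\<close> as the point at infinity. The sign of the second term is the one for which
  \<open>\<xi>\<close> is a fixed point: \<open>\<xi> = t + u / \<xi>\<close> is the equation \<open>\<xi>\<^sup>2 - t * \<xi> - u = 0\<close>.
  (The sign in \<open>svm - \<epsilon>s\<^sup>2v/x\<close> is a misprint: \<open>\<xi>\<close> is not fixed by that map, and for
  \<open>s = v = m = \<epsilon> = 1\<close> that map sends infinity to 1, 0, infinity, ..., whereas the Pellian
  fractions for the golden ratio are quotients of consecutive Fibonacci numbers.)\<close>

fun f_xi :: "int \<Rightarrow> int \<Rightarrow> int \<Rightarrow> int \<Rightarrow> real option \<Rightarrow> real option" where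
  "f_xi s v m \<epsilon> None = Some (of_int (s * v * m))"
| "f_xi s v m \<epsilon> (Some x) =
     (if x = 0 then None else Some (of_int (s * v * m) + of_int (\<epsilon> * s\<^sup>2 * v) / x))"

definition pellian :: "int \<Rightarrow> int \<Rightarrow> int \<Rightarrow> int \<Rightarrow> bool" where
  "pellian t u p q \<longleftrightarrow>
     q > 0 \<and> (of_int p / of_int q :: real) > of_int t / 2 \<and>
     (p\<^sup>2 - t * p * q - u * q\<^sup>2 = 1 \<or> p\<^sup>2 - t * p * q - u * q\<^sup>2 = -1)"

fun pell :: "nat \<Rightarrow> nat" where
  "pell 0 = 0"
| "pell (Suc 0) = 1"
| "pell (Suc (Suc n)) = 2 * pell (Suc n) + pell n"

end

theory Submission
  imports Defs
begin

text \<open>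
  Put \<open>\<eta> = \<xi> / s\<close>, a root of \<open>y\<^sup>2 - v m y - \<epsilon> v\<close>. A Pellian fraction \<open>p / q\<close> corresponds to the
  unit \<open>p - q s \<eta>'\<close> of \<open>\<int>[\<eta>]\<close> that exceeds its conjugate in absolute value (\<open>\<eta>'\<close> the conjugate
  of \<open>\<eta>\<close>), and applying \<open>f\<^sub>\<xi>\<close> to the fraction corresponds to multiplying the unit by \<open>\<eta>\<close>, up to
  rational factors. The unit \<open>\<omega> = \<eta>\<^sup>2 / v = (v m\<^sup>2 + \<epsilon>) - m \<eta>'\<close> has norm 1, so dividing a unit
  \<open>P - Q \<eta>'\<close> by \<open>\<omega>\<close> undoes two steps of the orbit and decreases \<open>Q\<close>. Hence only units with
  \<open>Q \<le> m\<close> have to be inspected. The only ones outside the orbit have norm \<open>-1\<close> and occur for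
  \<open>\<epsilon> = -1\<close> and \<open>(v, m) = (1, 3), (5, 1), (2, 2)\<close>; there the units of norm \<open>-1\<close> are the odd powers
  of the golden ratio or of \<open>1 + \<surd>2\<close>, so that \<open>Q\<close>, a multiple of \<open>s\<close>, is a Fibonacci or Pell
  number of odd index.
\<close>

section \<open>Units of the quadratic order and their place in the orbit\<close>

definition unit_norm :: "int \<Rightarrow> int \<Rightarrow> int \<Rightarrow> int \<Rightarrow> int \<Rightarrow> int" where
  "unit_norm v m \<epsilon> P Q = P\<^sup>2 - v * m * P * Q - \<epsilon> * v * Q\<^sup>2"

text \<open>A Pellian fraction \<open>p / q\<close> has \<open>P = p\<close> and
  \<open>Q = q * s\<close>, hence the factor \<open>s\<close>.\<close>

definition in_orbit :: "int \<Rightarrow> int \<Rightarrow> int \<Rightarrow> int \<Rightarrow> int \<Rightarrow> int \<Rightarrow> bool" where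
  "in_orbit s v m \<epsilon> P Q \<longleftrightarrow>
     (\<exists>n\<ge>1. (f_xi s v m \<epsilon> ^^ n) None = Some (of_int s * of_int P / of_int Q))"

text \<open>The coordinates of \<open>(P - Q \<eta>') / \<omega>\<close>.\<close>

definition descP :: "int \<Rightarrow> int \<Rightarrow> int \<Rightarrow> int \<Rightarrow> int \<Rightarrow> int" where
  "descP v m \<epsilon> P Q = \<epsilon> * (P - v * m * Q)"

definition descQ :: "int \<Rightarrow> int \<Rightarrow> int \<Rightarrow> int \<Rightarrow> int \<Rightarrow> int" where
  "descQ v m \<epsilon> P Q = (v * m\<^sup>2 + \<epsilon>) * Q - m * P"

text \<open>\<open>\<omega>\<close> has norm 1.\<close>

lemma unit_norm_desc:
  assumes "\<epsilon> \<in> {1, -1}"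
  shows "unit_norm v m \<epsilon> (descP v m \<epsilon> P Q) (descQ v m \<epsilon> P Q) = unit_norm v m \<epsilon> P Q"
  using assms
  by (auto simp: unit_norm_def descP_def descQ_def power2_eq_square algebra_simps)

lemma discriminant_bounds:
  fixes v m \<epsilon> :: int
  assumes "v > 0" "m > 0" "\<epsilon> \<in> {1, -1}" "\<not> (\<epsilon> = -1 \<and> v * m\<^sup>2 \<le> 4)"
  shows "v * m\<^sup>2 + 2 * \<epsilon> \<ge> 3" "v * (v * m\<^sup>2 + 4 * \<epsilon>) \<ge> 2"
proof -
  have vm: "v * m\<^sup>2 > 0" using assms by simp
  have eps: "\<epsilon> = 1 \<or> (\<epsilon> = -1 \<and> \<not> v * m\<^sup>2 \<le> 4)" using assms by auto
  show "v * m\<^sup>2 + 2 * \<epsilon> \<ge> 3" using eps vm by linarith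
  have pos: "v * m\<^sup>2 + 4 * \<epsilon> \<ge> 1" using eps vm by linarith
  show "v * (v * m\<^sup>2 + 4 * \<epsilon>) \<ge> 2"
  proof (cases "v \<ge> 2")
    case True
    have "2 * 1 \<le> v * (v * m\<^sup>2 + 4 * \<epsilon>)"
      using mult_mono[OF True pos] True by simp
    then show ?thesis by simp
  next
    case False
    then have v1: "v = 1" using assms by simp
    have "\<epsilon> = -1 \<Longrightarrow> m \<ge> 3"
    proof (rule ccontr)
      assume "\<epsilon> = -1" "\<not> m \<ge> 3"
      then have "m = 1 \<or> m = 2" using assms by linarith
      then show False using assms \<open>\<epsilon> = -1\<close> v1 by auto
    qed
    then have "\<epsilon> = -1 \<Longrightarrow> m\<^sup>2 \<ge> 3\<^sup>2" by (intro power_mono) auto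
    then show ?thesis using assms v1 vm by auto
  qed
qed

section \<open>Descent: division by \<open>\<omega>\<close>\<close>

context
  fixes v m \<epsilon> :: int
  assumes v: "v > 0" and m: "m > 0" and eps: "\<epsilon> \<in> {1, -1}"
    and nexc: "\<not> (\<epsilon> = -1 \<and> v * m\<^sup>2 \<le> 4)"
begin

text \<open>\<open>T\<close> is the trace of \<open>\<omega>\<close>, \<open>D\<close> the discriminant of \<open>\<eta>\<close>, and \<open>X P Q\<close> the trace of
  \<open>P - Q \<eta>'\<close>.\<close>

private definition "T = v * m\<^sup>2 + 2 * \<epsilon>"
private definition "D = v * (v * m\<^sup>2 + 4 * \<epsilon>)"
private definition "X P Q = 2 * P - v * m * Q"

private lemma eps_sq: "\<epsilon> * \<epsilon> = 1"
  using eps by auto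

private lemma T_ge: "T \<ge> 3" and D_ge: "D \<ge> 2"
  unfolding T_def D_def using discriminant_bounds[OF v m eps nexc] by auto

text \<open>The unit \<open>\<omega> = (T + m * \<surd>D) / 2\<close> has norm 1.\<close>

private lemma T_sq: "T\<^sup>2 = m\<^sup>2 * D + 4"
  using eps_sq unfolding T_def D_def by algebra

private lemma X_sq: "(X P Q)\<^sup>2 = D * Q\<^sup>2 + 4 * unit_norm v m \<epsilon> P Q"
  unfolding X_def D_def unit_norm_def by algebra

text \<open>Since \<open>P - Q * \<eta>' = (X P Q + Q * \<surd>D) / 2\<close>, multiplying by
  \<open>(T - m * \<surd>D) / 2\<close>, the inverse of \<open>\<omega>\<close>, gives this as the
  coefficient of \<open>\<surd>D\<close>; the rational part gives \<open>X_desc_eq\<close>.\<close>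

private lemma descQ_eq: "2 * descQ v m \<epsilon> P Q = T * Q - m * X P Q"
  unfolding descQ_def T_def X_def by algebra

private lemma X_desc_eq:
  "2 * X (descP v m \<epsilon> P Q) (descQ v m \<epsilon> P Q) = T * X P Q - m * D * Q"
  unfolding descQ_def descP_def T_def X_def D_def by algebra

text \<open>Each inequality compares two nonnegative quantities through their squares, whose
  difference \<open>T_sq\<close> and \<open>X_sq\<close> make explicit. Equality in the first is
  possible only for \<open>Q = m\<close>, where the quotient is 1.\<close>

private lemma desc_pos_one:
  assumes "unit_norm v m \<epsilon> P Q = 1" "X P Q > 0" "Q \<ge> m"
  shows "descQ v m \<epsilon> P Q \<ge> 0" "descQ v m \<epsilon> P Q < Q"
    "X (descP v m \<epsilon> P Q) (descQ v m \<epsilon> P Q) > 0"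
proof -
  have Q: "Q > 0" and QQ: "m\<^sup>2 \<le> Q\<^sup>2" using assms m by (auto intro: power_mono)
  have X2: "(X P Q)\<^sup>2 = D * Q\<^sup>2 + 4" using X_sq assms by simp
  have "(T * Q)\<^sup>2 - (m * X P Q)\<^sup>2 = 4 * Q\<^sup>2 - 4 * m\<^sup>2"
    using X2 T_sq by algebra
  then have "(m * X P Q)\<^sup>2 \<le> (T * Q)\<^sup>2" using QQ by linarith
  then have "m * X P Q \<le> T * Q"
    by (rule power2_le_imp_le) (use T_ge Q in simp)
  then show "descQ v m \<epsilon> P Q \<ge> 0" using descQ_eq[of P Q] by linarith
  have "(m * X P Q)\<^sup>2 - ((T - 2) * Q)\<^sup>2 = 4 * ((T - 2) * Q\<^sup>2) + 4 * m\<^sup>2"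
    using X2 T_sq by algebra
  moreover have "(T - 2) * Q\<^sup>2 > 0" using T_ge Q by simp
  moreover have "m\<^sup>2 > 0" using m by simp
  ultimately have "((T - 2) * Q)\<^sup>2 < (m * X P Q)\<^sup>2" by linarith
  then have "(T - 2) * Q < m * X P Q"
    by (rule power2_less_imp_less) (use m assms in simp)
  then show "descQ v m \<epsilon> P Q < Q" using descQ_eq[of P Q] by (simp add: algebra_simps)
  have "(T * X P Q)\<^sup>2 - (m * D * Q)\<^sup>2 = 4 * (D * Q\<^sup>2) + 4 * T\<^sup>2"
    using X2 T_sq by algebra
  moreover have "D * Q\<^sup>2 > 0" using D_ge Q by simp
  moreover have "T\<^sup>2 \<ge> 0" by simp
  ultimately have "(m * D * Q)\<^sup>2 < (T * X P Q)\<^sup>2" by linarith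
  then have "m * D * Q < T * X P Q"
    by (rule power2_less_imp_less) (use T_ge assms in simp)
  then show "X (descP v m \<epsilon> P Q) (descQ v m \<epsilon> P Q) > 0"
    using X_desc_eq[of P Q] by linarith
qed

text \<open>The same comparison of squares; with norm -1 the last two inequalities rest on
  \<open>Q \<ge> m + 1\<close>.\<close>

private lemma desc_pos_minus_one:
  assumes "unit_norm v m \<epsilon> P Q = -1" "X P Q > 0" "Q > m"
  shows "descQ v m \<epsilon> P Q > 0" "descQ v m \<epsilon> P Q < Q"
    "X (descP v m \<epsilon> P Q) (descQ v m \<epsilon> P Q) > 0"
proof -
  have Q: "Q > 0" and QQ: "(m + 1)\<^sup>2 \<le> Q\<^sup>2" using assms m by (auto intro: power_mono)
  have X2: "(X P Q)\<^sup>2 = D * Q\<^sup>2 - 4" using X_sq assms by simp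
  have "(T * Q)\<^sup>2 - (m * X P Q)\<^sup>2 = 4 * Q\<^sup>2 + 4 * m\<^sup>2"
    using X2 T_sq by algebra
  moreover have "Q\<^sup>2 > 0" using Q by simp
  moreover have "m\<^sup>2 > 0" using m by simp
  ultimately have "(m * X P Q)\<^sup>2 < (T * Q)\<^sup>2" by linarith
  then have "m * X P Q < T * Q"
    by (rule power2_less_imp_less) (use T_ge Q in simp)
  then show "descQ v m \<epsilon> P Q > 0" using descQ_eq[of P Q] by linarith
  have m1: "(m + 1)\<^sup>2 = m\<^sup>2 + 2 * m + 1" by (simp add: power2_eq_square algebra_simps)
  have "(m * X P Q)\<^sup>2 - ((T - 2) * Q)\<^sup>2 = 4 * ((T - 2) * Q\<^sup>2) - 4 * m\<^sup>2"
    using X2 T_sq by algebra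
  moreover have "1 * Q\<^sup>2 \<le> (T - 2) * Q\<^sup>2" using T_ge by (intro mult_right_mono) auto
  ultimately have "((T - 2) * Q)\<^sup>2 < (m * X P Q)\<^sup>2" using QQ m1 m by linarith
  then have "(T - 2) * Q < m * X P Q"
    by (rule power2_less_imp_less) (use m assms in simp)
  then show "descQ v m \<epsilon> P Q < Q" using descQ_eq[of P Q] by (simp add: algebra_simps)
  have "(T * X P Q)\<^sup>2 - (m * D * Q)\<^sup>2 = 4 * (D * Q\<^sup>2) - 4 * T\<^sup>2"
    using X2 T_sq by algebra
  \<comment> \<open>The surplus \<open>D * (2 * m + 1) \<ge> 6\<close> outweighs the 4 in
    \<open>T\<^sup>2 = m\<^sup>2 * D + 4\<close>.\<close>
  moreover have "D * (m + 1)\<^sup>2 \<le> D * Q\<^sup>2" using QQ D_ge by (intro mult_left_mono) auto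
  moreover have "D * (m + 1)\<^sup>2 = m\<^sup>2 * D + D * (2 * m + 1)"
    using m1 by (simp add: algebra_simps)
  moreover have "2 * 3 \<le> D * (2 * m + 1)" using D_ge m by (intro mult_mono) auto
  ultimately have "(m * D * Q)\<^sup>2 < (T * X P Q)\<^sup>2" using T_sq by linarith
  then have "m * D * Q < T * X P Q"
    by (rule power2_less_imp_less) (use T_ge assms in simp)
  then show "X (descP v m \<epsilon> P Q) (descQ v m \<epsilon> P Q) > 0"
    using X_desc_eq[of P Q] by linarith
qed

private lemma P_pos:
  assumes "X P Q > 0" "Q \<ge> 0"
  shows "P > 0"
proof -
  have "v * m * Q \<ge> 0" using v m assms by simp
  then show ?thesis using assms unfolding X_def by linarith
qed

text \<open>Two applications of \<open>f_xi\<close> lead from \<open>s * P1 / Q1\<close> through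
  \<open>s * v * Q / P1\<close> to \<open>s * P / Q\<close>; positivity keeps every denominator away
  from 0.\<close>

private lemma in_orbit_desc:
  assumes s: "s > 0" and Q: "Q > 0"
    and P': "descP v m \<epsilon> P Q > 0" and Q': "descQ v m \<epsilon> P Q > 0"
    and orb: "in_orbit s v m \<epsilon> (descP v m \<epsilon> P Q) (descQ v m \<epsilon> P Q)"
  shows "in_orbit s v m \<epsilon> P Q"
proof -
  define P1 Q1 where "P1 = descP v m \<epsilon> P Q" and "Q1 = descQ v m \<epsilon> P Q"
  have pos: "P1 > 0" "Q1 > 0" using P' Q' P1_def Q1_def by auto
  have "v * m * P1 + \<epsilon> * v * Q1 = v * Q"
    unfolding P1_def Q1_def descP_def descQ_def using eps_sq by algebra
  then have e1: "real_of_int v * m * P1 + \<epsilon> * v * Q1 = real_of_int v * real_of_int Q"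
    by (metis of_int_add of_int_mult)
  have "v * m * Q + \<epsilon> * P1 = P"
    unfolding P1_def descP_def using eps_sq by algebra
  then have e2: "real_of_int v * m * Q + \<epsilon> * P1 = P"
    by (metis of_int_add of_int_mult)
  have "f_xi s v m \<epsilon> (Some (of_int s * of_int P1 / of_int Q1))
      = Some (of_int s * (real_of_int v * m * P1 + \<epsilon> * v * Q1) / P1)"
    using pos s by (simp add: field_simps power2_eq_square)
  also have "\<dots> = Some (of_int s * (real_of_int v * Q) / P1)" by (simp only: e1)
  also have "f_xi s v m \<epsilon> \<dots> = Some (of_int s * (real_of_int v * m * Q + \<epsilon> * P1) / Q)"
    using pos s Q v by (simp add: field_simps power2_eq_square)
  also have "\<dots> = Some (of_int s * of_int P / of_int Q)" by (simp only: e2)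
  finally have step: "f_xi s v m \<epsilon> (f_xi s v m \<epsilon> (Some (of_int s * of_int P1 / of_int Q1)))
      = Some (of_int s * of_int P / of_int Q)" .
  obtain n where "n \<ge> 1" "(f_xi s v m \<epsilon> ^^ n) None = Some (of_int s * of_int P1 / of_int Q1)"
    using orb unfolding in_orbit_def P1_def Q1_def by auto
  then have "(f_xi s v m \<epsilon> ^^ (Suc (Suc n))) None = Some (of_int s * of_int P / of_int Q)"
    using step by simp
  then show ?thesis unfolding in_orbit_def by (intro exI[of _ "Suc (Suc n)"]) simp
qed

section \<open>Base cases: the first orbit points and the units with small \<open>Q\<close>\<close>

text \<open>For \<open>v = 1\<close> the number \<open>\<eta> = m - \<eta>'\<close> is itself a
  unit.\<close>

private lemma in_orbit_first:
  assumes "v = 1"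
  shows "in_orbit s v m \<epsilon> m 1"
  unfolding in_orbit_def using assms by (intro exI[of _ 1]) simp

text \<open>This is the unit \<open>\<omega>\<close>.\<close>

private lemma in_orbit_second:
  assumes "s > 0"
  shows "in_orbit s v m \<epsilon> (v * m\<^sup>2 + \<epsilon>) m"
proof -
  have "(f_xi s v m \<epsilon> ^^ 2) None = Some (of_int s * of_int (v * m\<^sup>2 + \<epsilon>) / of_int m)"
    using assms v m by (simp add: numeral_2_eq_2 field_simps power2_eq_square)
  then show ?thesis unfolding in_orbit_def by (intro exI[of _ 2]) simp
qed

text \<open>The norm equation factors as \<open>P * R = \<epsilon> * v * Q\<^sup>2 + 1\<close>. For
  \<open>R = 0\<close> the unit is \<open>\<eta>\<close>; for \<open>R \<noteq> 0\<close> the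
  product is too large in absolute value.\<close>

private lemma small_unit_norm_one:
  assumes N: "unit_norm v m \<epsilon> P Q = 1" and X: "X P Q > 0" and Q: "Q > 0" and Qm: "Q < m"
  shows "v = 1 \<and> P = m \<and> Q = 1"
proof -
  define R where "R = P - v * m * Q"
  have P: "P > 0" using P_pos X Q by simp
  have PR: "P * R = \<epsilon> * v * Q\<^sup>2 + 1"
    using N unfolding unit_norm_def R_def by algebra
  have vQ: "v * Q\<^sup>2 \<ge> 1" using v Q by (simp add: int_one_le_iff_zero_less)
  have "v * Q * (Q + 1) \<le> v * Q * m" using v Q Qm by (intro mult_left_mono) auto
  then have vmQ: "v * Q\<^sup>2 + v * Q \<le> v * m * Q" by (simp add: power2_eq_square algebra_simps)
  have vQ0: "v * Q > 0" using v Q by simp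
  consider "R = 0" | "R \<ge> 1" | "R \<le> -1" by linarith
  then show ?thesis
  proof cases
    case 1
    then have "\<epsilon> * v * Q\<^sup>2 = -1" using PR by simp
    then have "\<epsilon> = -1" "v * Q\<^sup>2 = 1" using eps vQ by auto
    then have "v = 1" "Q = 1" using v Q by (auto simp: zmult_eq_1_iff power2_eq_1_iff)
    then show ?thesis using 1 unfolding R_def by simp
  next
    case 2
    have "P * 1 \<le> P * R" using 2 P by (intro mult_left_mono) auto
    moreover have "P \<ge> v * m * Q + 1" using 2 unfolding R_def by simp
    ultimately show ?thesis using PR vmQ vQ0 vQ eps by auto
  next
    case 3
    have neg: "P * R < 0" using 3 P by (simp add: mult_pos_neg)
    then have e: "\<epsilon> = -1" using PR vQ eps by auto
    \<comment> \<open>As \<open>v * m * Q + R = P\<close>, the positive integers \<open>P\<close>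
      and \<open>- R\<close> have sum \<open>v * m * Q\<close>, so their product is at least
      \<open>v * m * Q - 1\<close>; it equals \<open>v * Q\<^sup>2 - 1\<close>.\<close>
    have "(- R - 1) * (v * m * Q + R - 1) \<ge> 0"
      using 3 P unfolding R_def by (intro mult_nonneg_nonneg) auto
    moreover have "(- R - 1) * (v * m * Q + R - 1) = - (P * R) - v * m * Q + 1"
      unfolding R_def by algebra
    ultimately show ?thesis using PR e vmQ vQ0 by auto
  qed
qed

text \<open>The same factorisation, but for \<open>R < 0\<close> the product is
  \<open>v * Q\<^sup>2 + 1\<close>, which leaves \<open>v * Q * (m - Q) \<le> 2\<close> and so
  finitely many exceptions.\<close>

private lemma small_unit_norm_minus_one:
  assumes N: "unit_norm v m \<epsilon> P Q = -1" and X: "X P Q > 0" and Q: "Q > 0" and Qm: "Q \<le> m"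
  shows "(\<epsilon> = 1 \<and> v = 1 \<and> P = m \<and> Q = 1) \<or>
    (\<epsilon> = -1 \<and> (v, m) \<in> {(1, 3), (5, 1), (2, 2)})"
proof -
  define R where "R = P - v * m * Q"
  have P: "P > 0" using P_pos X Q by simp
  have PR: "P * R = \<epsilon> * v * Q\<^sup>2 - 1"
    using N unfolding unit_norm_def R_def by algebra
  have vQ: "v * Q\<^sup>2 \<ge> 1" using v Q by (simp add: int_one_le_iff_zero_less)
  have "v * Q * Q \<le> v * Q * m" using v Q Qm by (intro mult_left_mono) auto
  then have vmQ: "v * Q\<^sup>2 \<le> v * m * Q" by (simp add: power2_eq_square algebra_simps)
  consider "R = 0" | "R \<ge> 1" | "R \<le> -1" by linarith
  then show ?thesis
  proof cases
    case 1
    then have "\<epsilon> * v * Q\<^sup>2 = 1" using PR by simp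
    then have "\<epsilon> = 1" "v * Q\<^sup>2 = 1" using eps vQ by auto
    then have "v = 1" "Q = 1" using v Q by (auto simp: zmult_eq_1_iff power2_eq_1_iff)
    then show ?thesis using 1 \<open>\<epsilon> = 1\<close> unfolding R_def by simp
  next
    case 2
    have "P * 1 \<le> P * R" using 2 P by (intro mult_left_mono) auto
    moreover have "P \<ge> v * m * Q + 1" using 2 unfolding R_def by simp
    ultimately show ?thesis using PR vmQ vQ eps by auto
  next
    case 3
    have neg: "P * R < 0" using 3 P by (simp add: mult_pos_neg)
    then have e: "\<epsilon> = -1" using PR vQ eps by auto
    then have vm5: "v * m\<^sup>2 \<ge> 5" using nexc by auto
    have PR': "- (P * R) = v * Q\<^sup>2 + 1" using PR e by simp
    have XR: "v * m * Q + 2 * R > 0" using X unfolding X_def R_def by (simp add: algebra_simps)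
    have "(- R - 1) * (v * m * Q + R - 1) \<ge> 0"
      using 3 P unfolding R_def by (intro mult_nonneg_nonneg) auto
    moreover have "(- R - 1) * (v * m * Q + R - 1) = - (P * R) - v * m * Q + 1"
      unfolding R_def by algebra
    moreover have "v * Q * (m - Q) = v * m * Q - v * Q\<^sup>2" by algebra
    ultimately have le2: "v * Q * (m - Q) \<le> 2" using PR' by linarith
    show ?thesis
    proof (cases "Q = m")
      case True
      have "R \<noteq> -1"
      proof
        assume "R = -1"
        then have "P = v * Q\<^sup>2 + 1" "P = v * m * Q - 1" using PR' R_def by auto
        then show False using True by (simp add: power2_eq_square)
      qed
      \<comment> \<open>Now \<open>- R \<ge> 2\<close>, and \<open>X P Q > 0\<close> says
        \<open>P > - R\<close>; so both factors are nonnegative, which forces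
        \<open>v * m\<^sup>2 \<le> 5\<close>.\<close>
      then have "(- R - 2) * (v * m * Q + R - 2) \<ge> 0"
        using 3 XR by (intro mult_nonneg_nonneg) auto
      moreover have "(- R - 2) * (v * m * Q + R - 2) = - (P * R) - 2 * (v * m * Q) + 4"
        unfolding R_def by algebra
      moreover have "v * m * Q = v * m\<^sup>2" using True by (simp add: power2_eq_square)
      moreover have "- (P * R) = v * m\<^sup>2 + 1" using PR' True by simp
      ultimately have vm: "v * m\<^sup>2 = 5" using vm5 by linarith
      have "m = 1"
      proof (rule ccontr)
        assume "m \<noteq> 1"
        then have "2 \<le> m" using m by simp
        then have "2\<^sup>2 \<le> m\<^sup>2" by (intro power_mono) auto
        moreover have "m\<^sup>2 \<le> 5" using vm by (metis dvd_triv_right zdvd_imp_le zero_less_numeral)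
        moreover have "m < 3"
        proof (rule ccontr)
          assume "\<not> m < 3"
          then have "3\<^sup>2 \<le> m\<^sup>2" by (intro power_mono) auto
          then show False using \<open>m\<^sup>2 \<le> 5\<close> by simp
        qed
        ultimately have "m = 2" using \<open>2 \<le> m\<close> by simp
        then have "v * 4 = 5" using vm by simp
        then show False by presburger
      qed
      then show ?thesis using vm e by simp
    next
      case False
      then have d: "m - Q \<ge> 1" using Qm by simp
      have vQ1: "v * Q \<ge> 1" using v Q by (simp add: int_one_le_iff_zero_less)
      have "v * Q * 1 \<le> v * Q * (m - Q)" using d vQ1 by (intro mult_left_mono) auto
      then have "v * Q \<le> 2" using le2 by simp
      moreover have "v * 1 \<le> v * Q" "1 * Q \<le> v * Q"
        using v Q by (auto intro: mult_left_mono mult_right_mono)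
      ultimately have "v = 1 \<or> v = 2" "Q = 1 \<or> Q = 2" using v Q by linarith+
      moreover have "m = 1 \<Longrightarrow> False" using False Q Qm by simp
      moreover have "v = 1 \<Longrightarrow> m \<noteq> 2" using vm5 by auto
      ultimately show ?thesis using le2 e d m by auto
    qed
  qed
qed

section \<open>Induction on \<open>Q\<close>\<close>

lemma norm_one_in_orbit:
  assumes s: "s > 0"
  shows "unit_norm v m \<epsilon> P Q = 1 \<Longrightarrow> 2 * P > v * m * Q \<Longrightarrow> Q > 0 \<Longrightarrow> in_orbit s v m \<epsilon> P Q"
proof (induction "nat Q" arbitrary: P Q rule: less_induct)
  case less
  have X: "X P Q > 0" using less.prems unfolding X_def by simp
  show ?case
  proof (cases "Q < m")
    case True
    then show ?thesis using small_unit_norm_one less.prems X in_orbit_first by blast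
  next
    case False
    define P1 Q1 where "P1 = descP v m \<epsilon> P Q" and "Q1 = descQ v m \<epsilon> P Q"
    have Q1: "Q1 \<ge> 0" "Q1 < Q" "X P1 Q1 > 0"
      using desc_pos_one[OF less.prems(1) X] False unfolding P1_def Q1_def by auto
    have N1: "unit_norm v m \<epsilon> P1 Q1 = 1"
      using unit_norm_desc[OF eps] less.prems unfolding P1_def Q1_def by simp
    have P1: "P1 > 0" using P_pos Q1 by simp
    show ?thesis
    proof (cases "Q1 = 0")
      case True
      \<comment> \<open>The quotient is 1, so the unit is \<open>\<omega>\<close>.\<close>
      then have "P1 = 1" using N1 P1 by (simp add: unit_norm_def power2_eq_1_iff)
      moreover have "Q = m * P1 + \<epsilon> * Q1" "P = v * m * Q + \<epsilon> * P1"
        unfolding P1_def Q1_def descP_def descQ_def using eps_sq by algebra+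
      ultimately have "Q = m" "P = v * m\<^sup>2 + \<epsilon>" using True by (simp_all add: power2_eq_square)
      then show ?thesis using in_orbit_second[OF s] by simp
    next
      case False
      then have "in_orbit s v m \<epsilon> P1 Q1"
        using less.hyps[of Q1 P1] Q1 N1 unfolding X_def by simp
      then show ?thesis
        using in_orbit_desc[OF s] less.prems P1 Q1 False unfolding P1_def Q1_def by simp
    qed
  qed
qed

text \<open>The descent leaves \<open>v\<close>, \<open>m\<close>, \<open>\<epsilon>\<close>
  unchanged, so an exception met at the bottom is one for the original unit.\<close>

lemma norm_minus_one_in_orbit_or_exceptional:
  assumes s: "s > 0"
  shows "unit_norm v m \<epsilon> P Q = -1 \<Longrightarrow> 2 * P > v * m * Q \<Longrightarrow> Q > 0 \<Longrightarrow>
    in_orbit s v m \<epsilon> P Q \<or> (\<epsilon> = -1 \<and> (v, m) \<in> {(1, 3), (5, 1), (2, 2)})"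
proof (induction "nat Q" arbitrary: P Q rule: less_induct)
  case less
  have X: "X P Q > 0" using less.prems unfolding X_def by simp
  show ?case
  proof (cases "Q \<le> m")
    case True
    then show ?thesis
      using small_unit_norm_minus_one less.prems X in_orbit_first by blast
  next
    case False
    define P1 Q1 where "P1 = descP v m \<epsilon> P Q" and "Q1 = descQ v m \<epsilon> P Q"
    have Q1: "Q1 > 0" "Q1 < Q" "X P1 Q1 > 0"
      using desc_pos_minus_one[OF less.prems(1) X] False unfolding P1_def Q1_def by auto
    have N1: "unit_norm v m \<epsilon> P1 Q1 = -1"
      using unit_norm_desc[OF eps] less.prems unfolding P1_def Q1_def by simp
    have P1: "P1 > 0" using P_pos Q1 by simp
    have "in_orbit s v m \<epsilon> P1 Q1 \<or> (\<epsilon> = -1 \<and> (v, m) \<in> {(1, 3), (5, 1), (2, 2)})"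
      using less.hyps[of Q1 P1] Q1 N1 unfolding X_def by simp
    then show ?thesis
      using in_orbit_desc[OF s] less.prems P1 Q1 unfolding P1_def Q1_def by blast
  qed
qed

end

section \<open>Units of norm -1 and Fibonacci or Pell numbers\<close>

text \<open>With \<open>\<theta>\<^sup>2 = c * \<theta> + 1\<close>, the powers are
  \<open>\<theta>^n = g (n + 1) - g n * \<theta>'\<close>. Descent by
  \<open>\<theta>\<^sup>2\<close> ends at \<open>\<theta>\<close>.\<close>

lemma norm_minus_one_odd_index:
  fixes c a y :: int and g :: "nat \<Rightarrow> int"
  assumes c: "c > 0" and g: "g 0 = 0" "g 1 = 1" "\<And>n. g (n + 2) = c * g (n + 1) + g n"
  shows "a > 0 \<Longrightarrow> y > 0 \<Longrightarrow> a\<^sup>2 - c * a * y - y\<^sup>2 = -1 \<Longrightarrow>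
    \<exists>n. y = g (2 * n + 1) \<and> a = g (2 * n + 2)"
proof (induction "nat y" arbitrary: a y rule: less_induct)
  case less
  show ?case
  proof (cases "y = 1")
    case True
    then have "a * (a - c) = 0" using less.prems by algebra
    then have "a = c" using less.prems by simp
    moreover have "g 2 = c" using g(3)[of 0] g by (simp add: numeral_2_eq_2)
    ultimately show ?thesis using True g by (intro exI[of _ 0]) simp
  next
    case False
    \<comment> \<open>Two backward steps of the recurrence; each flips the sign of the norm.\<close>
    define a1 where "a1 = a - c * y"
    define y1 where "y1 = y - c * a1"
    have "y * y > 1 * 1" using False less.prems by (intro mult_strict_mono) auto
    moreover have eq: "a * a1 = y * y - 1" using less.prems unfolding a1_def by algebra
    ultimately have "a * a1 > 0" by simp
    then have a1: "a1 > 0" using less.prems by (simp add: zero_less_mult_iff)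
    \<comment> \<open>Otherwise \<open>y \<le> c * a1\<close> and \<open>a * a1\<close> would exceed
      \<open>y * y\<close>, although it is \<open>y * y - 1\<close>.\<close>
    have "y1 > 0"
    proof (rule ccontr)
      assume "\<not> y1 > 0"
      then have "y * y \<le> (c * a1) * y"
        unfolding y1_def using less.prems by (intro mult_right_mono) auto
      moreover have "a1 * a1 > 0" using a1 by simp
      moreover have "a * a1 = a1 * a1 + (c * a1) * y" unfolding a1_def by algebra
      ultimately show False using eq by linarith
    qed
    moreover have "y1 < y" unfolding y1_def using c a1 by simp
    moreover have "a1\<^sup>2 - c * a1 * y1 - y1\<^sup>2 = -1"
      using less.prems unfolding y1_def a1_def by algebra
    ultimately obtain n where n: "y1 = g (2 * n + 1)" "a1 = g (2 * n + 2)"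
      using less.hyps[of y1 a1] a1 by auto
    have "y = g (2 * n + 3)"
      using g(3)[of "2 * n + 1"] n unfolding y1_def by (simp add: numeral_eq_Suc)
    moreover from this have "a = g (2 * n + 4)"
      using g(3)[of "2 * n + 2"] n unfolding a1_def by (simp add: numeral_eq_Suc)
    ultimately show ?thesis by (intro exI[of _ "n + 1"]) (simp add: numeral_eq_Suc)
  qed
qed

lemma norm_minus_one_fib:
  fixes a y :: int
  assumes "a > 0" "y > 0" "a\<^sup>2 - a * y - y\<^sup>2 = -1"
  shows "\<exists>n. y = int (fib (2 * n + 1))"
  using norm_minus_one_odd_index[of 1 "\<lambda>n. int (fib n)" a y] assms by auto

lemma norm_minus_one_pell:
  fixes a y :: int
  assumes "a > 0" "y > 0" "a\<^sup>2 - 2 * a * y - y\<^sup>2 = -1"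
  shows "\<exists>n. y = int (pell (2 * n + 1))"
  using norm_minus_one_odd_index[of 2 "\<lambda>n. int (pell n)" a y] assms by auto

section \<open>The exceptional values of \<open>\<xi>\<close>\<close>

lemma sqrt_mult_sq_div:
  fixes s c b :: real
  assumes "s > 0" "b > 0"
  shows "sqrt (s\<^sup>2 * c / b\<^sup>2) = s * sqrt c / b"
  using assms by (simp add: real_sqrt_mult real_sqrt_divide)

lemma xi_1_3: "s > 0 \<Longrightarrow> xi s 1 3 (-1) = of_int s * ((3 + sqrt 5) / 2)"
  using sqrt_mult_sq_div[of "of_int s" 2 5]
  by (simp add: xi_def dd_def kk_def field_simps)

lemma xi_5_1: "s > 0 \<Longrightarrow> xi s 5 1 (-1) = of_int s * ((5 + sqrt 5) / 2)"
  using sqrt_mult_sq_div[of "of_int s" 2 5]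
  by (simp add: xi_def dd_def kk_def field_simps)

lemma xi_2_2: "s > 0 \<Longrightarrow> xi s 2 2 (-1) = of_int s * (2 + sqrt 2)"
  using sqrt_mult_sq_div[of "of_int s" 1 2]
  by (simp add: xi_def dd_def kk_def field_simps)

section \<open>From Pellian fractions to units\<close>

theorem theorem6p6:
  fixes s v m \<epsilon> :: int
  assumes "s > 0" and "v > 0" and "m > 0" and "\<epsilon> \<in> {1, -1}"
    and "\<not> (\<epsilon> = -1 \<and> v * m\<^sup>2 \<le> 4)"
    and "\<not> ((xi s v m \<epsilon> = of_int s * ((3 + sqrt 5) / 2) \<or>
              xi s v m \<epsilon> = of_int s * ((5 + sqrt 5) / 2)) \<and>
             (\<exists>n. s dvd int (fib (2 * n + 1))))"
    and "\<not> (xi s v m \<epsilon> = of_int s * (2 + sqrt 2) \<and>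
             (\<exists>n. s dvd int (pell (2 * n + 1))))"
  shows "{Some (of_int p / of_int q :: real) | p q. pellian (trc s v m) (ncf s v \<epsilon>) p q}
           \<subseteq> {(f_xi s v m \<epsilon> ^^ n) None | n. n \<ge> 1}"
proof -
  have "in_orbit s v m \<epsilon> p (q * s)" if pq: "pellian (trc s v m) (ncf s v \<epsilon>) p q" for p q
  proof -
    \<comment> \<open>The conjugate of \<open>\<xi>\<close> is \<open>s * \<eta>'\<close>.\<close>
    define Q where "Q = q * s"
    have q: "q > 0" using pq unfolding pellian_def by simp
    then have Q: "Q > 0" unfolding Q_def using assms by simp
    have "real_of_int (2 * p) > real_of_int (v * m * Q)"
      using pq q unfolding pellian_def trc_def Q_def by (simp add: field_simps)
    then have big: "2 * p > v * m * Q" by (simp only: of_int_less_iff)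
    have "p\<^sup>2 - trc s v m * p * q - ncf s v \<epsilon> * q\<^sup>2 = unit_norm v m \<epsilon> p Q"
      unfolding unit_norm_def trc_def ncf_def Q_def by algebra
    then consider "unit_norm v m \<epsilon> p Q = 1" | "unit_norm v m \<epsilon> p Q = -1"
      using pq unfolding pellian_def by auto
    then have "in_orbit s v m \<epsilon> p Q"
    proof cases
      case 1
      then show ?thesis using norm_one_in_orbit assms big Q by blast
    next
      case 2
      have dvd: "s dvd Q" unfolding Q_def by simp
      show ?thesis
      proof (rule ccontr)
        assume "\<not> in_orbit s v m \<epsilon> p Q"
        then have e: "\<epsilon> = -1" and "(v, m) \<in> {(1, 3), (5, 1), (2, 2)}"
          using norm_minus_one_in_orbit_or_exceptional[OF assms(2-5,1) 2 big Q] by auto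
        then consider "v = 1" "m = 3" | "v = 5" "m = 1" | "v = 2" "m = 2" by auto
        then show False
        proof cases
          case a: 1
          \<comment> \<open>Here \<open>\<eta> = \<phi> + 1\<close> with the golden ratio
            \<open>\<phi>\<close>, so
            \<open>p - Q * \<eta>' = (p - Q) - Q * \<phi>'\<close>.\<close>
          have "(p - Q)\<^sup>2 - (p - Q) * Q - Q\<^sup>2 = -1"
            using 2 a e unfolding unit_norm_def by (simp add: power2_eq_square algebra_simps)
          then obtain n where "Q = int (fib (2 * n + 1))"
            using norm_minus_one_fib[of "p - Q" Q] big a Q by auto
          then show False using assms dvd xi_1_3 a e by metis
        next
          case a: 2
          \<comment> \<open>Here \<open>\<eta> = \<phi> + 2\<close>.\<close>
          have "(p - 2 * Q)\<^sup>2 - (p - 2 * Q) * Q - Q\<^sup>2 = -1"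
            using 2 a e unfolding unit_norm_def by (simp add: power2_eq_square algebra_simps)
          then obtain n where "Q = int (fib (2 * n + 1))"
            using norm_minus_one_fib[of "p - 2 * Q" Q] big a Q by auto
          then show False using assms dvd xi_5_1 a e by metis
        next
          case a: 3
          \<comment> \<open>Here \<open>\<eta> = \<theta> + 1\<close> with
            \<open>\<theta> = 1 + \<surd>2\<close>.\<close>
          have "(p - Q)\<^sup>2 - 2 * (p - Q) * Q - Q\<^sup>2 = -1"
            using 2 a e unfolding unit_norm_def by (simp add: power2_eq_square algebra_simps)
          then obtain n where "Q = int (pell (2 * n + 1))"
            using norm_minus_one_pell[of "p - Q" Q] big a Q by auto
          then show False using assms dvd xi_2_2 a e by metis
        qed
      qed
    qed
    then show ?thesis unfolding Q_def .
  qed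
  moreover have "of_int s * of_int p / of_int (q * s) = (of_int p / of_int q :: real)" for p q
    using assms by simp
  ultimately have "\<exists>n\<ge>1. (f_xi s v m \<epsilon> ^^ n) None = Some (of_int p / of_int q)"
    if "pellian (trc s v m) (ncf s v \<epsilon>) p q" for p q
    using that unfolding in_orbit_def by simp
  then show ?thesis by (smt (verit) mem_Collect_eq subsetI)
qed

end
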